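(* Let $q\in[0,1/2]$, let $(T_n)_{n\ge1}$ be the BCMRT$(q)$ process, and let $$S_n=\sum_{e\in E_n}|T_n^{e_+}|\,|T_n^{e_-}| .$$ Then $\mathbf E_q[S_n]\sim 4n^2\log n$ as $n\to\infty$.
   Context: BCMRT$(q)$ (balanced community modulated random recursive tree), $q\in[0,1]$: $T_1$ is a single edge (the root edge) joining two nodes with time-label $1$, one of type $A$, denoted $(1,A)$, and one of type $B$, denoted $(1,B)$. At each step $n\ge 2$, two new nodes with time-label $n$, namely $(n,A)$ of type $A$ and $(n,B)$ of type $B$, are added to the tree $T_{n-1}$ of size $2(n-1)$: (1) the two nodes independently (of each other and of the past) decide to connect to a node of their own type with probability $1-q$, or to a node of the other type with probability $q$; (2) each then independently chooses its parent uniformly among the $n-1$ nodes of $T_{n-1}$ of the selected type and is joined to it by an edge. This yields the tree $T_n$ of size $2n$. $\mathbf E_q$ is expectation under BCMRT$(q)$. $E_n$ is the edge set of $T_n$. For each $e\in E_n$ with an arbitrary orientation $e=(e_-,e_+)$, $T_n^{e_+}$ (resp. $T_n^{e_-}$) is the component containing $e_+$ (resp. $e_-$) after removing the edge $e$ from $T_n$, and $|\cdot|$ is the number of nodes. The notation $a_n\sim b_n$ means $a_n/b_n\to1$. *)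

theory Defs
  imports "HOL-Probability.Probability" "HOL-Library.Landau_Symbols"
begin

datatype community = TypeA | TypeB

fun other :: "community \<Rightarrow> community" where
  "other TypeA = TypeB"
| "other TypeB = TypeA"

type_synonym node = "nat \<times> community"

text \<open>A tree is given by its set of undirected edges, each edge being the set of its two endpoints.\<close>

type_synonym tree = "node set set"

definition nodes :: "nat \<Rightarrow> node set" where
  "nodes n = {1..n} \<times> UNIV"

text \<open>The law of the parent, in a tree with node set \<open>nodes n\<close>, of a new node of type \<open>t\<close>.\<close>

definition parent_pmf :: "real \<Rightarrow> nat \<Rightarrow> community \<Rightarrow> node pmf" where
  "parent_pmf q n t = do {
     switch \<leftarrow> bernoulli_pmf q;
     pmf_of_set {v \<in> nodes n. snd v = (if switch then other t else t)}
   }"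

definition bcmrt_step :: "real \<Rightarrow> nat \<Rightarrow> tree \<Rightarrow> tree pmf" where
  "bcmrt_step q n E = do {
     a \<leftarrow> parent_pmf q n TypeA;
     b \<leftarrow> parent_pmf q n TypeB;
     return_pmf (E \<union> {{(Suc n, TypeA), a}, {(Suc n, TypeB), b}})
   }"

text \<open>
  The law of \<open>T\<^sub>n\<close>. As time-labels are part of the nodes, \<open>T\<^sub>n\<close> determines the whole trajectory
  \<open>T\<^sub>1, \<dots>, T\<^sub>n\<close>, so this law carries the joint law of the process up to time \<open>n\<close>.
  The process starts at \<open>n = 1\<close>; the value at \<open>0\<close> is a dummy.
\<close>

fun bcmrt :: "real \<Rightarrow> nat \<Rightarrow> tree pmf" where
  "bcmrt q 0 = return_pmf {}"
| "bcmrt q (Suc 0) = return_pmf {{(1, TypeA), (1, TypeB)}}"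
| "bcmrt q (Suc (Suc n)) = bcmrt q (Suc n) \<bind> bcmrt_step q (Suc n)"

definition component :: "tree \<Rightarrow> node \<Rightarrow> node set" where
  "component E v = {w. (v, w) \<in> {(x, y). {x, y} \<in> E}\<^sup>*}"

text \<open>
  The product over the two endpoints \<open>v\<close> of \<open>e\<close> is the product of the sizes of the two components
  left after deleting \<open>e\<close>; it involves no choice of orientation.
\<close>

definition edge_sum :: "tree \<Rightarrow> nat" where
  "edge_sum E = (\<Sum>e\<in>E. \<Prod>v\<in>e. card (component (E - {e}) v))"

end

theory Submission imports Defs "HOL-Real_Asymp.Real_Asymp" begin

text \<open>
  The edge sum of a tree is its Wiener index, the sum of the distances over unordered pairs of
  nodes. Attaching two leaves at \<open>a\<close> and \<open>b\<close> to a tree with \<open>2n\<close> nodes adds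
  \<open>D(a) + D(b) + d(a,b) + 4n + 2\<close> to it, where \<open>D(v)\<close> is the sum of the distances to \<open>v\<close>.
  The two parents have marginals whose average is uniform, for every \<open>q\<close>, so \<open>D(a) + D(b)\<close> has
  conditional mean \<open>2S\<^sub>n/n\<close>, while \<open>d(a,b)\<close> has conditional mean between \<open>0\<close> and
  \<open>S\<^sub>n/n\<^sup>2\<close>. With \<open>s\<^sub>n\<close> the expectation of \<open>S\<^sub>n\<close>, \<open>s\<^sub>n\<^sub>+\<^sub>1\<close> hence lies between
  \<open>(1 + 2/n) s\<^sub>n + 4n + 2\<close> and \<open>(1 + 1/n)\<^sup>2 s\<^sub>n + 4n + 2\<close>. Dividing \<open>s\<^sub>n\<close> by \<open>n(n + 1)\<close> for
  the lower and by \<open>n\<^sup>2\<close> for the upper bound makes both recursions telescope, to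
  \<open>4 log n + O(1)\<close>.
\<close>

section \<open>Connectivity in trees built leaf by leaf\<close>

definition joined :: "tree \<Rightarrow> (node \<times> node) set" where
  "joined E = {(x, y). {x, y} \<in> E}\<^sup>*"

text \<open>In a tree, the distance is the number of edges separating the two nodes.\<close>

definition tree_dist :: "tree \<Rightarrow> node \<Rightarrow> node \<Rightarrow> nat" where
  "tree_dist E u v = card {e \<in> E. (u, v) \<notin> joined (E - {e})}"

text \<open>Trees are generated by attaching leaves, which is also how the process grows. Facts
  about deleted edges thus follow by induction, without a theory of paths and cycles.\<close>

inductive tree_on :: "node set \<Rightarrow> tree \<Rightarrow> bool" where
  tree_on_single: "tree_on {x} {}"
| tree_on_leaf: "tree_on V E \<Longrightarrow> p \<in> V \<Longrightarrow> w \<notin> V \<Longrightarrow> tree_on (insert w V) (insert {w, p} E)"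

lemma joined_sym: "(x, y) \<in> joined E \<Longrightarrow> (y, x) \<in> joined E"
proof -
  have "sym {(x, y). {x, y} \<in> E}"
    by (auto simp: sym_def insert_commute)
  then show "(x, y) \<in> joined E \<Longrightarrow> (y, x) \<in> joined E"
    unfolding joined_def by (meson sym_rtrancl symD)
qed

lemma joined_mono: "E \<subseteq> F \<Longrightarrow> joined E \<subseteq> joined F"
  unfolding joined_def by (rule rtrancl_mono) auto

lemma joined_refl [simp]: "(x, x) \<in> joined E"
  by (simp add: joined_def)

lemma joined_trans: "(x, y) \<in> joined E \<Longrightarrow> (y, z) \<in> joined E \<Longrightarrow> (x, z) \<in> joined E"
  unfolding joined_def by (rule rtrancl_trans)

lemma joined_edge: "{x, y} \<in> E \<Longrightarrow> (x, y) \<in> joined E"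
  by (auto simp: joined_def)

lemma joined_induct [consumes 1, case_names refl step]:
  assumes "(x, y) \<in> joined E" "P x"
    and "\<And>y z. (x, y) \<in> joined E \<Longrightarrow> {y, z} \<in> E \<Longrightarrow> P y \<Longrightarrow> P z"
  shows "P y"
  using assms(1) unfolding joined_def
  by (induction rule: rtrancl_induct) (use assms(2,3) in \<open>auto simp: joined_def\<close>)

lemma component_joined: "component E v = {w. (v, w) \<in> joined E}"
  by (simp add: component_def joined_def)

text \<open>The map \<open>id(w := p)\<close> contracts the pendant edge. Each edge of the larger
  graph is collapsed or left alone by it, and each node is joined to its image.\<close>

lemma joined_leaf_iff:
  assumes w: "w \<notin> \<Union>E"
  shows "(u, v) \<in> joined (insert {w, p} E) \<longleftrightarrow> ((id(w := p)) u, (id(w := p)) v) \<in> joined E"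
    (is "_ \<longleftrightarrow> (?f u, ?f v) \<in> _")
proof
  assume "(u, v) \<in> joined (insert {w, p} E)"
  then show "(?f u, ?f v) \<in> joined E"
  proof (induction rule: joined_induct)
    case (step y z)
    then consider "{y, z} = {w, p}" | "{y, z} \<in> E" by auto
    then show ?case
    proof cases
      case 1
      then have "?f y = ?f z" by (auto simp: doubleton_eq_iff)
      then show ?thesis using step.IH by metis
    next
      case 2
      then have "?f y = y" "?f z = z" using w by auto
      then show ?thesis using step.IH joined_trans[OF _ joined_edge[OF 2]] by simp
    qed
  qed simp
next
  let ?J = "joined (insert {w, p} E)"
  assume "(?f u, ?f v) \<in> joined E"
  then have 1: "(?f u, ?f v) \<in> ?J"
    using joined_mono[of E "insert {w, p} E"] by blast
  have f: "(x, ?f x) \<in> ?J" for x by (auto intro: joined_edge)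
  show "(u, v) \<in> ?J"
    using f[of u] 1 joined_sym[OF f[of v]] by (meson joined_trans)
qed

lemma tree_on_finite: "tree_on V E \<Longrightarrow> finite V \<and> finite E"
  by (induction rule: tree_on.induct) auto

lemma tree_on_Union: "tree_on V E \<Longrightarrow> \<Union>E \<subseteq> V"
  by (induction rule: tree_on.induct) auto

lemma tree_on_edgeE:
  assumes "tree_on V E" "e \<in> E"
  obtains x y where "e = {x, y}" "x \<noteq> y"
  using assms by (induction arbitrary: thesis rule: tree_on.induct) blast+

lemma tree_on_joined: "tree_on V E \<Longrightarrow> u \<in> V \<Longrightarrow> v \<in> V \<Longrightarrow> (u, v) \<in> joined E"
proof (induction arbitrary: u v rule: tree_on.induct)
  case (tree_on_leaf V E p w)
  have w: "w \<notin> \<Union>E" using tree_on_leaf tree_on_Union by blast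
  show ?case unfolding joined_leaf_iff[OF w]
    by (rule tree_on_leaf.IH) (use tree_on_leaf in auto)
qed simp

lemma joined_isolated: "w \<notin> \<Union>E \<Longrightarrow> (w, v) \<in> joined E \<longleftrightarrow> v = w"
  by (auto simp: joined_def elim: converse_rtranclE)

text \<open>By induction on the last leaf: the deleted edge is either the one carrying that leaf, or
  an older one, in which case contracting the leaf reduces to the smaller tree.\<close>

lemma tree_on_cut:
  assumes "tree_on V E" "{x, y} \<in> E"
  shows "(x, y) \<notin> joined (E - {{x, y}})"
    and "component (E - {{x, y}}) x \<union> component (E - {{x, y}}) y = V"
proof -
  have "(x, y) \<notin> joined (E - {{x, y}}) \<and>
    (\<forall>v. v \<in> V \<longleftrightarrow> (x, v) \<in> joined (E - {{x, y}}) \<or> (y, v) \<in> joined (E - {{x, y}}))"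
    using assms
  proof (induction arbitrary: x y rule: tree_on.induct)
    case (tree_on_leaf V E p w)
    have w: "w \<notin> \<Union>E" using tree_on_leaf tree_on_Union by blast
    have pw: "p \<noteq> w" using tree_on_leaf by auto
    \<comment> \<open>When the new edge is deleted, \<open>E\<close> remains; there \<open>p\<close>
      reaches exactly \<open>V\<close>, and the isolated \<open>w\<close> only itself.\<close>
    have conn: "(p, v) \<in> joined E \<longleftrightarrow> v \<in> V" for v
    proof
      assume "(p, v) \<in> joined E"
      then show "v \<in> V"
        by (induction rule: joined_induct)
          (use tree_on_leaf tree_on_Union[of V E] in auto)
    qed (use tree_on_leaf tree_on_joined in auto)
    show ?case
    proof (cases "{x, y} = {w, p}")
      case True
      have "{w, p} \<notin> E" using w by auto
      then have E: "insert {w, p} E - {{x, y}} = E" using True by simp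
      from True consider "x = w" "y = p" | "x = p" "y = w"
        by (auto simp: doubleton_eq_iff)
      then show ?thesis unfolding E
        using joined_isolated[OF w] conn pw joined_sym tree_on_leaf.hyps
        by cases auto
    next
      case False
      then have xy: "{x, y} \<in> E" using tree_on_leaf.prems by simp
      have E: "insert {w, p} E - {{x, y}} = insert {w, p} (E - {{x, y}})"
        using False by auto
      have w': "w \<notin> \<Union>(E - {{x, y}})" using w by blast
      have "x \<noteq> w" "y \<noteq> w" using xy w by auto
      \<comment> \<open>The new leaf falls on the side that contains its neighbour
        \<open>p\<close>.\<close>
      moreover have "(x, p) \<in> joined (E - {{x, y}}) \<or> (y, p) \<in> joined (E - {{x, y}})"
        using tree_on_leaf.IH[OF xy] tree_on_leaf.hyps by blast
      ultimately show ?thesis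
        using tree_on_leaf.IH[OF xy] tree_on_leaf.hyps
        unfolding E joined_leaf_iff[OF w'] by auto
    qed
  qed simp
  then show "(x, y) \<notin> joined (E - {{x, y}})"
    and "component (E - {{x, y}}) x \<union> component (E - {{x, y}}) y = V"
    by (auto simp: component_joined)
qed

section \<open>Distances and the edge sum\<close>

lemma tree_dist_sym: "tree_dist E u v = tree_dist E v u"
  unfolding tree_dist_def using joined_sym by (metis (no_types))

text \<open>An old edge separates two nodes exactly if it separates their images under the
  contraction of the new edge; the new edge separates them exactly if one of them alone is
  \<open>w\<close>.\<close>

lemma tree_dist_leaf:
  assumes T: "tree_on V E" "p \<in> V" "w \<notin> V" and uv: "u \<in> insert w V" "v \<in> insert w V"
  shows "tree_dist (insert {w, p} E) u v =
    tree_dist E ((id(w := p)) u) ((id(w := p)) v) + (if (u = w) = (v = w) then 0 else 1)"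
    (is "_ = tree_dist E (?f u) (?f v) + _")
proof -
  let ?E = "insert {w, p} E" and ?l = "{w, p}"
  have w: "w \<notin> \<Union>E" using T tree_on_Union by blast
  have lE: "?l \<notin> E" using w by auto
  have fin: "finite E" using T tree_on_finite by auto
  have "(u, v) \<in> joined (?E - {e}) \<longleftrightarrow> (?f u, ?f v) \<in> joined (E - {e})" if "e \<in> E" for e
  proof -
    have E: "?E - {e} = insert ?l (E - {e})" using lE that by auto
    have w': "w \<notin> \<Union>(E - {e})" using w by blast
    show ?thesis unfolding E joined_leaf_iff[OF w'] ..
  qed
  then have split: "{e \<in> ?E. (u, v) \<notin> joined (?E - {e})} =
      {e \<in> E. (?f u, ?f v) \<notin> joined (E - {e})} \<union> (if (u, v) \<in> joined E then {} else {?l})"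
    using lE by auto
  have l: "(u, v) \<in> joined E \<longleftrightarrow> (u = w) = (v = w)"
    using uv joined_isolated[OF w] joined_sym tree_on_joined[OF T(1)] by blast
  show ?thesis unfolding tree_dist_def split using lE fin l by auto
qed

text \<open>Double counting of ordered pairs together with an edge separating them. The factor 2
  comes from ordering the pairs.\<close>

lemma edge_sum_eq_dist_sum:
  assumes T: "tree_on V E"
  shows "2 * edge_sum E = (\<Sum>u\<in>V. \<Sum>v\<in>V. tree_dist E u v)"
proof -
  have fin: "finite V" "finite E" using tree_on_finite[OF T] by auto
  have edge: "2 * (\<Prod>v\<in>e. card (component (E - {e}) v)) =
      card {(u, v) \<in> V \<times> V. (u, v) \<notin> joined (E - {e})}" if eE: "e \<in> E" for e
  proof -
    obtain x y where e: "e = {x, y}" "x \<noteq> y" using tree_on_edgeE[OF T eE] by blast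
    let ?X = "component (E - {e}) x" and ?Y = "component (E - {e}) y"
    have cut: "(x, y) \<notin> joined (E - {e})" "?X \<union> ?Y = V"
      using tree_on_cut[OF T] eE e by auto
    have disj: "?X \<inter> ?Y = {}"
      using cut(1) joined_sym unfolding component_joined by (blast intro: joined_trans)
    \<comment> \<open>A separated pair starts in one component and ends in the other: two disjoint
      rectangles of equal size.\<close>
    have "{(u, v) \<in> V \<times> V. (u, v) \<notin> joined (E - {e})} = ?X \<times> ?Y \<union> ?Y \<times> ?X"
      using cut joined_sym unfolding component_joined by (blast intro: joined_trans)
    moreover have "finite ?X" "finite ?Y" using cut fin by (metis finite_Un)+
    ultimately show ?thesis using e disj
      by (subst \<open>{(u, v) \<in> V \<times> V. _ u v} = _\<close>, subst card_Un_disjoint)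
        (auto simp: card_cartesian_product)
  qed
  have "2 * edge_sum E = (\<Sum>e\<in>E. card {(u, v) \<in> V \<times> V. (u, v) \<notin> joined (E - {e})})"
    unfolding edge_sum_def sum_distrib_left by (rule sum.cong) (use edge in auto)
  also have "\<dots> = (\<Sum>e\<in>E. \<Sum>z\<in>V \<times> V. if z \<notin> joined (E - {e}) then 1 else 0)"
    by (intro sum.cong refl) (auto simp: sum.If_cases fin intro!: arg_cong[of _ _ card])
  also have "\<dots> = (\<Sum>z\<in>V \<times> V. \<Sum>e\<in>E. if z \<notin> joined (E - {e}) then 1 else 0)"
    by (rule sum.swap)
  also have "\<dots> = (\<Sum>z\<in>V \<times> V. tree_dist E (fst z) (snd z))"
    unfolding tree_dist_def
    by (intro sum.cong refl) (auto simp: sum.If_cases fin intro!: arg_cong[of _ _ card])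
  finally show ?thesis by (simp add: sum.cartesian_product split_def)
qed

lemma edge_sum_leaf:
  assumes T: "tree_on V E" "p \<in> V" "w \<notin> V"
  shows "edge_sum (insert {w, p} E) = edge_sum E + (\<Sum>v\<in>V. tree_dist E p v) + card V"
proof -
  let ?E = "insert {w, p} E"
  have fin: "finite V" using tree_on_finite[OF T(1)] by auto
  have old: "tree_dist ?E u v = tree_dist E u v" if "u \<in> V" "v \<in> V" for u v
    using tree_dist_leaf[OF T, of u v] that T by auto
  have new: "tree_dist ?E w v = Suc (tree_dist E p v)" if "v \<in> V" for v
    using tree_dist_leaf[OF T, of w v] that T by auto
  have self: "tree_dist ?E w w = 0" by (simp add: tree_dist_def)
  have "2 * edge_sum ?E = (\<Sum>u\<in>insert w V. \<Sum>v\<in>insert w V. tree_dist ?E u v)"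
    by (rule edge_sum_eq_dist_sum) (use T in \<open>rule tree_on_leaf\<close>)
  also have "\<dots> = (\<Sum>v\<in>V. tree_dist ?E w v) + (\<Sum>u\<in>V. tree_dist ?E u w)
      + (\<Sum>u\<in>V. \<Sum>v\<in>V. tree_dist ?E u v)"
    using fin T(3) self by (simp add: sum.distrib)
  also have "(\<Sum>u\<in>V. tree_dist ?E u w) = (\<Sum>v\<in>V. tree_dist ?E w v)"
    by (simp add: tree_dist_sym)
  also have "(\<Sum>v\<in>V. tree_dist ?E w v) = (\<Sum>v\<in>V. tree_dist E p v) + card V"
    using new by (simp add: sum_Suc)
  also have "(\<Sum>u\<in>V. \<Sum>v\<in>V. tree_dist ?E u v) = 2 * edge_sum E"
    unfolding edge_sum_eq_dist_sum[OF T(1)] by (intro sum.cong refl old)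
  finally show ?thesis by simp
qed

text \<open>The leaves are attached one after the other. The second one also meets \<open>x\<close>,
  which lies at distance \<open>tree_dist E a b + 1\<close> from \<open>b\<close> and adds one more
  node to the count; this yields the mutual distance and the final 2.\<close>

lemma edge_sum_two_leaves:
  assumes T: "tree_on V E" "a \<in> V" "b \<in> V" "x \<notin> V" "y \<notin> V" "x \<noteq> y"
  shows "edge_sum (E \<union> {{x, a}, {y, b}}) = edge_sum E + (\<Sum>v\<in>V. tree_dist E a v)
    + (\<Sum>v\<in>V. tree_dist E b v) + tree_dist E a b + 2 * card V + 2"
proof -
  let ?E = "insert {x, a} E"
  have fin: "finite V" using tree_on_finite[OF T(1)] by auto
  have T': "tree_on (insert x V) ?E" by (rule tree_on_leaf) (use T in auto)
  have old: "tree_dist ?E b v = tree_dist E b v" if "v \<in> V" for v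
    using tree_dist_leaf[OF T(1,2,4), of b v] that T by auto
  have new: "tree_dist ?E b x = Suc (tree_dist E a b)"
    using tree_dist_leaf[OF T(1,2,4), of b x] T tree_dist_sym by auto
  have "edge_sum (insert {y, b} ?E) =
      edge_sum ?E + (\<Sum>v\<in>insert x V. tree_dist ?E b v) + card (insert x V)"
    by (rule edge_sum_leaf) (use T T' in auto)
  also have "(\<Sum>v\<in>insert x V. tree_dist ?E b v) = Suc (tree_dist E a b) + (\<Sum>v\<in>V. tree_dist E b v)"
    using fin T(4) new old by simp
  also have "edge_sum ?E = edge_sum E + (\<Sum>v\<in>V. tree_dist E a v) + card V"
    by (rule edge_sum_leaf) (use T in auto)
  also have "insert {y, b} ?E = E \<union> {{x, a}, {y, b}}" by auto
  finally show ?thesis using fin T(4) by simp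
qed

section \<open>The parent law and the support of the process\<close>

lemma UNIV_community: "(UNIV :: community set) = {TypeA, TypeB}"
  using community.exhaust by auto

lemma finite_nodes [simp]: "finite (nodes n)"
  by (simp add: nodes_def UNIV_community)

lemma card_nodes: "card (nodes n) = 2 * n"
  by (simp add: nodes_def UNIV_community card_cartesian_product)

text \<open>Meant as the mass function of \<open>parent_pmf\<close> on \<open>nodes n\<close> only.
  It need not vanish elsewhere, so sums against it range over \<open>nodes n\<close>.\<close>

definition parent_prob :: "real \<Rightarrow> nat \<Rightarrow> community \<Rightarrow> node \<Rightarrow> real" where
  "parent_prob q n t v = (if snd v = t then 1 - q else q) / real n"

text \<open>Whatever the type of \<open>v\<close>, one newcomer reaches it by switching and the
  other by not switching, so the weights \<open>q\<close> and \<open>1 - q\<close> add up to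
  1.\<close>

lemma parent_prob_add:
  "parent_prob q n TypeA v + parent_prob q n TypeB v = 1 / real n"
  by (cases "snd v") (auto simp: parent_prob_def simp flip: add_divide_distrib)

lemma nodes_of_type:
  "{v \<in> nodes n. snd v = c} = (\<lambda>i. (i, c)) ` {1..n}"
  by (auto simp: nodes_def)

lemma
  assumes "n \<ge> 1" and q: "0 \<le> q" "q \<le> 1"
  shows set_parent_pmf: "set_pmf (parent_pmf q n t) \<subseteq> nodes n"
    and expectation_parent_pmf:
      "measure_pmf.expectation (parent_pmf q n t) f = (\<Sum>v\<in>nodes n. parent_prob q n t v * f v)"
proof -
  \<comment> \<open>Non-emptiness, from \<open>n \<ge> 1\<close>, is what gives
    \<open>pmf_of_set\<close> its intended meaning.\<close>
  have set: "finite {v \<in> nodes n. snd v = c}" "{v \<in> nodes n. snd v = c} \<noteq> {}"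
    "card {v \<in> nodes n. snd v = c} = n" for c
    using assms(1) unfolding nodes_of_type by (auto simp: card_image inj_on_def)
  show S: "set_pmf (parent_pmf q n t) \<subseteq> nodes n"
    unfolding parent_pmf_def using set by (auto simp: set_pmf_of_set split: if_splits)
  have oth: "s = other t \<longleftrightarrow> s \<noteq> t" for s by (cases s; cases t) auto
  have "pmf (parent_pmf q n t) v = parent_prob q n t v" if "v \<in> nodes n" for v
    unfolding parent_pmf_def pmf_bind using set q that
    by (auto simp: pmf_of_set parent_prob_def oth indicator_def)
  then show "measure_pmf.expectation (parent_pmf q n t) f = (\<Sum>v\<in>nodes n. parent_prob q n t v * f v)"
    by (subst integral_measure_pmf[OF finite_nodes[of n]])
      (use S in \<open>auto intro!: sum.cong simp: mult.commute\<close>)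
qed

lemma nodes_Suc: "nodes (Suc n) = insert (Suc n, TypeB) (insert (Suc n, TypeA) (nodes n))"
  by (auto simp: nodes_def UNIV_community)

text \<open>Finite support is carried along because it makes every function of the tree integrable.
  The index starts at 1, as the dummy value at 0 is not a tree.\<close>

lemma bcmrt_tree:
  assumes q: "0 \<le> q" "q \<le> 1"
  shows "finite (set_pmf (bcmrt q (Suc n))) \<and> (\<forall>E \<in> set_pmf (bcmrt q (Suc n)). tree_on (nodes (Suc n)) E)"
proof (induction n)
  case 0
  have "tree_on (insert (Suc 0, TypeA) {(Suc 0, TypeB)}) (insert {(Suc 0, TypeA), (Suc 0, TypeB)} {})"
    by (rule tree_on_leaf[OF tree_on_single]) auto
  moreover have "nodes (Suc 0) = insert (Suc 0, TypeA) {(Suc 0, TypeB)}"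
    using community.exhaust by (auto simp: nodes_def)
  ultimately show ?case by simp
next
  case (Suc n)
  have S: "set_pmf (parent_pmf q (Suc n) t) \<subseteq> nodes (Suc n)" for t
    by (rule set_parent_pmf) (use q in auto)
  then have fin: "finite (set_pmf (parent_pmf q (Suc n) t))" for t
    by (rule finite_subset) simp
  have "tree_on (nodes (Suc (Suc n))) (E \<union> {{(Suc (Suc n), TypeA), a}, {(Suc (Suc n), TypeB), b}})"
    if "tree_on (nodes (Suc n)) E" "a \<in> nodes (Suc n)" "b \<in> nodes (Suc n)" for E a b
  proof -
    have "tree_on (insert (Suc (Suc n), TypeB) (insert (Suc (Suc n), TypeA) (nodes (Suc n))))
      (insert {(Suc (Suc n), TypeB), b} (insert {(Suc (Suc n), TypeA), a} E))"
      by (intro tree_on_leaf that) (use that in \<open>auto simp: nodes_def\<close>)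
    moreover have "insert {(Suc (Suc n), TypeB), b} (insert {(Suc (Suc n), TypeA), a} E)
      = E \<union> {{(Suc (Suc n), TypeA), a}, {(Suc (Suc n), TypeB), b}}" by auto
    ultimately show ?thesis by (simp only: nodes_Suc[of "Suc n"])
  qed
  then show ?case using Suc S fin by (fastforce simp: bcmrt_step_def)
qed

section \<open>Recursive bounds on the mean\<close>

text \<open>By independence the pair of parents has product weights. All terms of the increment are
  averaged exactly, except the mutual distance \<open>?X\<close>, which is only enclosed.\<close>

lemma expectation_step:
  assumes q: "0 \<le> q" "q \<le> 1" and n: "n \<ge> 1" and T: "tree_on (nodes n) E"
  defines "\<mu> \<equiv> measure_pmf.expectation (bcmrt_step q n E) (\<lambda>E. real (edge_sum E))"
  shows "(1 + 2 / real n) * real (edge_sum E) + 4 * real n + 2 \<le> \<mu>"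
    and "\<mu> \<le> (1 + 1 / real n)\<^sup>2 * real (edge_sum E) + 4 * real n + 2"
proof -
  let ?V = "nodes n" and ?P = "parent_prob q n TypeA" and ?Q = "parent_prob q n TypeB"
  let ?d = "\<lambda>u v. real (tree_dist E u v)" and ?S = "real (edge_sum E)"
  let ?D = "\<lambda>u. \<Sum>v\<in>?V. ?d u v"
  have S: "set_pmf (parent_pmf q n t) \<subseteq> ?V" for t
    by (rule set_parent_pmf) (use q n in auto)
  have fin: "finite (set_pmf (parent_pmf q n t))" for t
    by (rule finite_subset[OF S]) simp
  have ex: "measure_pmf.expectation (parent_pmf q n t) f = (\<Sum>v\<in>?V. parent_prob q n t v * f v)"
    for t and f :: "node \<Rightarrow> real"
    by (rule expectation_parent_pmf) (use q n in auto)
  have one: "(\<Sum>v\<in>?V. parent_prob q n t v) = 1" for t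
    using ex[of t "\<lambda>_. 1"] by simp
  have bind: "measure_pmf.expectation (parent_pmf q n t \<bind> f) h
      = (\<Sum>v\<in>?V. parent_prob q n t v * measure_pmf.expectation (f v) h)"
    if "\<And>v. finite (set_pmf (f v))" for t h and f :: "node \<Rightarrow> tree pmf"
    unfolding ex[symmetric]
    by (subst pmf_expectation_bind[OF finite_nodes[of n] that S])
      (subst integral_measure_pmf[OF finite_nodes[of n]], use S in auto)
  have DS: "(\<Sum>u\<in>?V. ?D u) = 2 * ?S"
    using arg_cong[OF edge_sum_eq_dist_sum[OF T], of real] by simp
  have es: "real (edge_sum (E \<union> {{(Suc n, TypeA), a}, {(Suc n, TypeB), b}}))
      = ?S + ?D a + ?D b + ?d a b + 4 * real n + 2" if "a \<in> ?V" "b \<in> ?V" for a b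
    by (subst edge_sum_two_leaves[OF T that]) (auto simp: card_nodes, auto simp: nodes_def)
  have "\<mu> = (\<Sum>a\<in>?V. ?P a * (\<Sum>b\<in>?V. ?Q b *
      real (edge_sum (E \<union> {{(Suc n, TypeA), a}, {(Suc n, TypeB), b}}))))"
    unfolding \<mu>_def bcmrt_step_def by (simp add: bind fin)
  also have "\<dots> = (\<Sum>a\<in>?V. ?P a * (\<Sum>b\<in>?V. ?Q b * (?S + ?D a + ?D b + ?d a b + 4 * real n + 2)))"
    by (intro sum.cong refl arg_cong2[of _ _ _ _ "(*)"] es)
  also have "\<dots> = (\<Sum>a\<in>?V. ?P a * ((?S + 4 * real n + 2) + ?D a + (\<Sum>b\<in>?V. ?Q b * ?D b)
      + (\<Sum>b\<in>?V. ?Q b * ?d a b)))"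
    by (intro sum.cong refl arg_cong2[of _ _ _ _ "(*)"])
      (simp add: distrib_left sum.distrib one flip: sum_distrib_right)
  also have "\<dots> = ?S + 4 * real n + 2 + (\<Sum>a\<in>?V. ?P a * ?D a) + (\<Sum>b\<in>?V. ?Q b * ?D b)
      + (\<Sum>a\<in>?V. ?P a * (\<Sum>b\<in>?V. ?Q b * ?d a b))"
    by (simp add: distrib_left sum.distrib one flip: sum_distrib_right)
  finally have mu: "\<mu> = ?S + 4 * real n + 2 + (\<Sum>a\<in>?V. ?P a * ?D a) + (\<Sum>b\<in>?V. ?Q b * ?D b)
      + (\<Sum>a\<in>?V. ?P a * (\<Sum>b\<in>?V. ?Q b * ?d a b))" .
  \<comment> \<open>Only the sum of the two marginals enters here, so \<open>q\<close>
    cancels.\<close>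
  have "(\<Sum>a\<in>?V. ?P a * ?D a) + (\<Sum>b\<in>?V. ?Q b * ?D b) = (\<Sum>a\<in>?V. 1 / real n * ?D a)"
    by (simp only: sum.distrib[symmetric] distrib_right[symmetric] parent_prob_add)
  also have "\<dots> = 2 / real n * ?S"
    by (simp only: sum_distrib_left[symmetric] DS)
  finally have lin: "(\<Sum>a\<in>?V. ?P a * ?D a) + (\<Sum>b\<in>?V. ?Q b * ?D b) = 2 / real n * ?S" .
  let ?X = "\<Sum>a\<in>?V. ?P a * (\<Sum>b\<in>?V. ?Q b * ?d a b)"
  have nn: "parent_prob q n t v \<ge> 0" for t v using q by (simp add: parent_prob_def)
  have X0: "?X \<ge> 0" by (intro sum_nonneg mult_nonneg_nonneg nn) auto
  have X1: "?X = (\<Sum>a\<in>?V. \<Sum>b\<in>?V. ?P a * ?Q b * ?d a b)"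
    by (simp add: sum_distrib_left mult.assoc)
  have X2: "?X = (\<Sum>a\<in>?V. \<Sum>b\<in>?V. ?P b * ?Q a * ?d a b)"
    unfolding X1 by (subst sum.swap) (simp add: tree_dist_sym)
  \<comment> \<open>Symmetrising in \<open>a\<close> and \<open>b\<close> gives weights bounded independently of the types.\<close>
  have "2 * ?X = (\<Sum>a\<in>?V. \<Sum>b\<in>?V. (?P a * ?Q b + ?P b * ?Q a) * ?d a b)"
    using X1 X2 by (simp add: distrib_right sum.distrib)
  also have "\<dots> \<le> (\<Sum>a\<in>?V. \<Sum>b\<in>?V. (1 / real n)\<^sup>2 * ?d a b)"
  proof (intro sum_mono mult_right_mono)
    fix a b
    \<comment> \<open>The right side exceeds the left by
      \<open>?P a * ?P b + ?Q a * ?Q b\<close>.\<close>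
    have "?P a * ?Q b + ?P b * ?Q a \<le> (?P a + ?Q a) * (?P b + ?Q b)"
      using nn by (simp add: algebra_simps)
    then show "?P a * ?Q b + ?P b * ?Q a \<le> (1 / real n)\<^sup>2"
      by (simp only: parent_prob_add power2_eq_square)
  qed auto
  also have "\<dots> = (1 / real n)\<^sup>2 * (2 * ?S)"
    by (simp only: sum_distrib_left[symmetric] DS)
  finally have X3: "?X \<le> (1 / real n)\<^sup>2 * ?S" by simp
  show "(1 + 2 / real n) * ?S + 4 * real n + 2 \<le> \<mu>"
    using mu lin X0 by (simp add: algebra_simps)
  \<comment> \<open>The square collects \<open>2 / n\<close> from \<open>lin\<close> and
    \<open>1 / n^2\<close> from \<open>X3\<close>.\<close>
  have "(1 + 1 / real n)\<^sup>2 * ?S = ?S + 2 / real n * ?S + (1 / real n)\<^sup>2 * ?S"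
    by (simp add: power2_eq_square algebra_simps)
  then show "\<mu> \<le> (1 + 1 / real n)\<^sup>2 * ?S + 4 * real n + 2"
    using mu lin X3 by linarith
qed

abbreviation mean_edge_sum :: "real \<Rightarrow> nat \<Rightarrow> real" where
  "mean_edge_sum q n \<equiv> measure_pmf.expectation (bcmrt q n) (\<lambda>E. real (edge_sum E))"

lemma mean_edge_sum_1: "mean_edge_sum q (Suc 0) = 1"
proof -
  have "component {} v = {v}" for v by (simp add: component_def)
  then show ?thesis by (simp add: edge_sum_def)
qed

text \<open>Conditioning on the tree at time \<open>n\<close>: both one-step bounds are affine in
  the edge sum, so they survive taking the expectation.\<close>

lemma mean_edge_sum_Suc:
  fixes n :: nat
  assumes q: "0 \<le> q" "q \<le> 1" and n: "n \<ge> 1"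
  shows "(1 + 2 / real n) * mean_edge_sum q n + 4 * real n + 2 \<le> mean_edge_sum q (Suc n)"
    and "mean_edge_sum q (Suc n) \<le> (1 + 1 / real n)\<^sup>2 * mean_edge_sum q n + 4 * real n + 2"
proof -
  let ?M = "bcmrt q n"
  let ?F = "\<lambda>E. measure_pmf.expectation (bcmrt_step q n E) (\<lambda>E. real (edge_sum E))"
  obtain m where m: "n = Suc m" using n by (cases n) auto
  have fin: "finite (set_pmf ?M)" and T: "\<And>E. E \<in> set_pmf ?M \<Longrightarrow> tree_on (nodes n) E"
    using bcmrt_tree[OF q, of m] m by auto
  have fin': "finite (set_pmf (bcmrt_step q n E))" for E
    using finite_subset[OF set_parent_pmf[OF n q] finite_nodes]
    by (auto simp: bcmrt_step_def)
  have eq: "mean_edge_sum q (Suc n) = measure_pmf.expectation ?M ?F"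
  proof -
    have "bcmrt q (Suc n) = ?M \<bind> bcmrt_step q n" using m by simp
    then show ?thesis
      by (simp only: pmf_expectation_bind[OF fin fin' subset_refl] integral_measure_pmf[OF fin])
  qed
  note int = integrable_measure_pmf_finite[OF fin]
  have affine: "measure_pmf.expectation ?M (\<lambda>E. c * real (edge_sum E) + 4 * real n + 2)
      = c * mean_edge_sum q n + 4 * real n + 2" for c
    by (simp add: int)
  show "(1 + 2 / real n) * mean_edge_sum q n + 4 * real n + 2 \<le> mean_edge_sum q (Suc n)"
    unfolding eq affine[symmetric]
    by (intro integral_mono_AE int AE_pmfI expectation_step(1)[OF q n T])
  show "mean_edge_sum q (Suc n) \<le> (1 + 1 / real n)\<^sup>2 * mean_edge_sum q n + 4 * real n + 2"
    unfolding eq affine[symmetric]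
    by (intro integral_mono_AE int AE_pmfI expectation_step(2)[OF q n T])
qed

section \<open>Solving the recursions and the asymptotics\<close>

text \<open>After division by \<open>n^2\<close> the increment is
  \<open>(4 n + 2) / (n + 1)^2\<close>, at most \<open>4 / (n + 1)\<close>. The constant 3 gives
  equality at \<open>n = 1\<close>.\<close>

lemma mean_edge_sum_upper:
  assumes q: "0 \<le> q" "q \<le> 1"
  shows "n \<ge> 1 \<Longrightarrow> mean_edge_sum q n \<le> (real n)\<^sup>2 * (4 * harm n - 3)"
proof (induction n rule: dec_induct)
  case base
  then show ?case using mean_edge_sum_1[of q] by (simp add: harm_def)
next
  case (step n)
  have "mean_edge_sum q (Suc n) \<le> (1 + 1 / real n)\<^sup>2 * mean_edge_sum q n + 4 * real n + 2"
    by (rule mean_edge_sum_Suc(2)[OF q]) (use step in simp)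
  also have "\<dots> \<le> (1 + 1 / real n)\<^sup>2 * ((real n)\<^sup>2 * (4 * harm n - 3)) + 4 * real n + 2"
    using step.IH by (intro add_right_mono mult_left_mono) auto
  also have "(1 + 1 / real n)\<^sup>2 * ((real n)\<^sup>2 * (4 * harm n - 3)) = (real n + 1)\<^sup>2 * (4 * harm n - 3)"
    using step.hyps by (simp add: power2_eq_square field_simps)
  also have "\<dots> + 4 * real n + 2 \<le> (real n + 1)\<^sup>2 * (4 * (harm n + 1 / (real n + 1)) - 3)"
    by (simp add: field_simps power2_eq_square)
  also have "\<dots> = (real (Suc n))\<^sup>2 * (4 * harm (Suc n) - 3)"
    by (simp add: harm_Suc field_simps)
  finally show ?case .
qed

text \<open>After division by \<open>n (n + 1)\<close> the increment is
  \<open>(4 n + 2) / ((n + 1) (n + 2))\<close>, which equals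
  \<open>4 / (n + 1) + 6 / (n + 2) - 6 / (n + 1)\<close> by partial fractions; the last two terms
  telescope. The constant \<open>13 / 2\<close> gives equality at \<open>n = 1\<close>.\<close>

lemma mean_edge_sum_lower:
  assumes q: "0 \<le> q" "q \<le> 1"
  shows "n \<ge> 1 \<Longrightarrow>
    real n * (real n + 1) * (4 * harm n + 6 / (real n + 1) - 13 / 2) \<le> mean_edge_sum q n"
proof (induction n rule: dec_induct)
  case base
  then show ?case using mean_edge_sum_1[of q] by (simp add: harm_def)
next
  case (step n)
  define h :: real where "h = harm n"
  have pos: "real n > 0" using step by simp
  have "real (Suc n) * (real (Suc n) + 1) * (4 * harm (Suc n) + 6 / (real (Suc n) + 1) - 13 / 2)
    = (real n + 1) * (real n + 2) * (4 * (h + 1 / (real n + 1)) + 6 / (real n + 2) - 13 / 2)"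
    by (simp add: harm_Suc h_def inverse_eq_divide add_ac)
  also have "\<dots> = (1 + 2 / real n) * (real n * (real n + 1) * (4 * h + 6 / (real n + 1) - 13 / 2))
      + 4 * real n + 2"
    using pos by (simp add: divide_simps) algebra
  also have "\<dots> \<le> (1 + 2 / real n) * mean_edge_sum q n + 4 * real n + 2"
    unfolding h_def by (intro add_right_mono mult_left_mono step.IH) auto
  also have "\<dots> \<le> mean_edge_sum q (Suc n)"
    by (rule mean_edge_sum_Suc(1)[OF q]) (use step in simp)
  finally show ?case .
qed

lemma harm_le_ln: "n \<ge> 1 \<Longrightarrow> harm n \<le> ln (real n) + 1"
proof (induction n rule: dec_induct)
  case base
  then show ?case by (simp add: harm_def)
next
  case (step n)
  \<comment> \<open>This says that \<open>ln (n + 1) - ln n\<close> is at least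
    \<open>1 / (n + 1)\<close>.\<close>
  have "ln (real n / real (Suc n)) \<le> real n / real (Suc n) - 1"
    by (rule ln_le_minus_one) (use step in simp)
  also have "\<dots> = - inverse (real (Suc n))" by (simp add: field_simps)
  finally show ?case using step by (simp add: harm_Suc ln_div)
qed

theorem proposition12:
  fixes q :: real
  assumes "0 \<le> q" and "q \<le> 1/2"
  shows "(\<lambda>n. measure_pmf.expectation (bcmrt q n) (\<lambda>E. real (edge_sum E)))
           \<sim>[at_top] (\<lambda>n. 4 * (real n)\<^sup>2 * ln (real n))"
proof (rule asymp_equivI')
  have q: "0 \<le> q" "q \<le> 1" using assms by auto
  let ?g = "\<lambda>n. 4 * (real n)\<^sup>2 * ln (real n)"
  let ?l = "\<lambda>n. real n * (real n + 1) * (4 * ln (real n) + 6 / (real n + 1) - 13 / 2)"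
  let ?u = "\<lambda>n. (real n)\<^sup>2 * (4 * (ln (real n) + 1) - 3)"
  show "(\<lambda>n. mean_edge_sum q n / ?g n) \<longlonglongrightarrow> 1"
  \<comment> \<open>Both bounds differ from \<open>?g\<close> by a term of order \<open>n^2\<close>,
    negligible against \<open>n^2 * ln n\<close>.\<close>
  proof (rule tendsto_sandwich)
    show "(\<lambda>n. ?l n / ?g n) \<longlonglongrightarrow> 1" by real_asymp
    show "(\<lambda>n. ?u n / ?g n) \<longlonglongrightarrow> 1" by real_asymp
    show "\<forall>\<^sub>F n in sequentially. ?l n / ?g n \<le> mean_edge_sum q n / ?g n"
      using eventually_ge_at_top[of 1]
    proof eventually_elim
      case (elim n)
      have "ln (real n) \<le> ln (real n + 1)" using elim by simp
      also have "\<dots> \<le> harm n" using ln_le_harm[of n] by simp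
      finally have "?l n \<le> real n * (real n + 1) * (4 * harm n + 6 / (real n + 1) - 13 / 2)"
        by (intro mult_left_mono) auto
      also have "\<dots> \<le> mean_edge_sum q n" by (rule mean_edge_sum_lower[OF q elim])
      \<comment> \<open>At \<open>n = 1\<close> the denominator is 0 and both quotients are 0 by
        convention.\<close>
      finally show ?case using elim by (intro divide_right_mono) auto
    qed
    show "\<forall>\<^sub>F n in sequentially. mean_edge_sum q n / ?g n \<le> ?u n / ?g n"
      using eventually_ge_at_top[of 1]
    proof eventually_elim
      case (elim n)
      have "mean_edge_sum q n \<le> (real n)\<^sup>2 * (4 * harm n - 3)"
        by (rule mean_edge_sum_upper[OF q elim])
      also have "\<dots> \<le> ?u n"
        using harm_le_ln[of n] elim by (intro mult_left_mono) auto
      finally show ?case using elim by (intro divide_right_mono) auto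
    qed
  qed
qed

end
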